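(* Let $G$ be an $r$-regular graph with $r>1$, $n$ vertices and $m$ edges, and let $\alpha\in[0,1]$. Let $\lambda_1(A(G)),\dots,\lambda_n(A(G))$ be the eigenvalues of the adjacency matrix $A(G)$. Then $A_\alpha(T(G))$ has $m-n$ eigenvalues equal to $2\alpha(r+1)-2$, and its other $2n$ eigenvalues are $$\frac12\Bigl(-2(\alpha-1)\bigl(\lambda_i(A(G))-1\bigr)+r(3\alpha+1)\pm(\alpha-1)\sqrt{4\lambda_i(A(G))+r^2+4}\Bigr),\quad i=1,\dots,n.$$
   Context: For a simple graph $G$ with adjacency matrix $A(G)$ and diagonal degree matrix $D(G)$, $A_\alpha(G)=\alpha D(G)+(1-\alpha)A(G)$. The total graph $T(G)$ has as vertices the vertices and edges of $G$, two of them being adjacent iff the corresponding elements of $G$ are adjacent (two vertices joined by an edge, or two edges sharing an endpoint) or incident (a vertex and an edge containing it). *)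

theory Defs
  imports
    "Jordan_Normal_Form.Char_Poly"
    "HOL-Library.Multiset"
    "HOL-Computational_Algebra.Polynomial"
begin

record 'v graph =
  vertices :: "'v set"
  edges :: "'v set set"

definition simple_graph :: "'v graph \<Rightarrow> bool" where
  "simple_graph G \<longleftrightarrow>
     finite (vertices G) \<and> (\<forall>e\<in>edges G. e \<subseteq> vertices G \<and> card e = 2)"

definition vertex_degree :: "'v graph \<Rightarrow> 'v \<Rightarrow> nat" where
  "vertex_degree G v = card {e \<in> edges G. v \<in> e}"

definition regular_graph :: "nat \<Rightarrow> 'v graph \<Rightarrow> bool" where
  "regular_graph r G \<longleftrightarrow> (\<forall>v\<in>vertices G. vertex_degree G v = r)"

text \<open>An edge of \<open>G\<close>, seen as a vertex of the total graph, is tagged by \<^const>\<open>Inr\<close>.\<close>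

definition total_graph :: "'v graph \<Rightarrow> ('v + 'v set) graph" where
  "total_graph G = \<lparr>
     vertices = Inl ` vertices G \<union> Inr ` edges G,
     edges = {{Inl u, Inl v} | u v. {u, v} \<in> edges G}
           \<union> {{Inr e, Inr f} | e f. e \<in> edges G \<and> f \<in> edges G \<and> e \<noteq> f \<and> e \<inter> f \<noteq> {}}
           \<union> {{Inl v, Inr e} | v e. e \<in> edges G \<and> v \<in> e}\<rparr>"

lemma simple_graph_total_graph:
  assumes "simple_graph G"
  shows "simple_graph (total_graph G)"
proof -
  have "finite (edges G)"
    using assms by (auto simp: simple_graph_def intro: finite_subset[of _ "Pow (vertices G)"])
  moreover have "u \<noteq> v" if "{u, v} \<in> edges G" for u v
    using assms that by (force simp: simple_graph_def)
  moreover have "v \<in> vertices G" if "e \<in> edges G" "v \<in> e" for v e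
    using assms that by (auto simp: simple_graph_def)
  ultimately show ?thesis
    using assms by (auto simp: simple_graph_def total_graph_def card_insert_if)
qed

text \<open>
  The matrices below are taken with respect to a list \<open>vs\<close> that enumerates the vertices
  of \<open>G\<close> without repetition; row and column \<open>i\<close> belong to the vertex \<open>vs ! i\<close>.
\<close>

definition enumerates :: "'a list \<Rightarrow> 'a set \<Rightarrow> bool" where
  "enumerates xs S \<longleftrightarrow> distinct xs \<and> set xs = S"

definition adjacency_matrix :: "'v graph \<Rightarrow> 'v list \<Rightarrow> real mat" where
  "adjacency_matrix G vs = mat (length vs) (length vs)
     (\<lambda>(i, j). if {vs ! i, vs ! j} \<in> edges G then 1 else 0)"

definition degree_matrix :: "'v graph \<Rightarrow> 'v list \<Rightarrow> real mat" where
  "degree_matrix G vs = mat_diag (length vs) (\<lambda>i. real (vertex_degree G (vs ! i)))"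

definition A_alpha_matrix :: "real \<Rightarrow> 'v graph \<Rightarrow> 'v list \<Rightarrow> real mat" where
  "A_alpha_matrix \<alpha> G vs =
     \<alpha> \<cdot>\<^sub>m degree_matrix G vs + (1 - \<alpha>) \<cdot>\<^sub>m adjacency_matrix G vs"

text \<open>
  The real eigenvalues, each as often as its algebraic multiplicity. For the real symmetric
  matrices above these are all the eigenvalues.
\<close>

definition eigenvalue_mset :: "real mat \<Rightarrow> real multiset" where
  "eigenvalue_mset M = proots (char_poly M)"

end

theory Submission
  imports Defs
begin

text \<open>
  Let \<open>B\<close> be the vertex-edge incidence matrix of \<open>G\<close>, so that \<open>B B\<^sup>T = A + r I\<close>, while
  \<open>B\<^sup>T B - 2 I\<close> is the adjacency matrix of the line graph. The total graph then has the adjacency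
  matrix with blocks \<open>A\<close>, \<open>B\<close>, \<open>B\<^sup>T\<close>, \<open>B\<^sup>T B - 2 I\<close>, and eliminating the edge block expresses its
  characteristic polynomial at \<open>x\<close> by a determinant of a quadratic polynomial in \<open>A\<close>. For large
  \<open>x\<close> this quadratic splits over the reals, so the determinant is a product of two values of the
  characteristic polynomial of \<open>A\<close>, hence a product over the eigenvalues of \<open>A\<close>; rewritten as a
  polynomial in \<open>x\<close>, each factor has discriminant \<open>4 \<lambda> + r\<^sup>2 + 4\<close>, which is nonnegative because
  \<open>\<lambda> \<ge> - r\<close>. As the total graph is \<open>2 r\<close>-regular, its \<open>A\<^sub>\<alpha>\<close> is
  \<open>2 \<alpha> r I + (1 - \<alpha>) A(T(G))\<close>.
\<close>

section \<open>Reindexing of matrices and linear polynomials in a matrix\<close>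

text \<open>Two enumerations of one set differ by a permutation \<open>\<sigma>\<close>, and
  conjugation by its permutation matrix carries one matrix to the other. This allows the total graph
  to be listed with vertices first and edges last, whatever \<open>ts\<close> is.\<close>

lemma similar_mat_reindex:
  fixes F :: "'a \<Rightarrow> 'a \<Rightarrow> 'b :: field"
  assumes xs: "enumerates xs S" and ys: "enumerates ys S"
  shows "similar_mat (mat (length xs) (length xs) (\<lambda>(i, j). F (xs ! i) (xs ! j)))
                     (mat (length ys) (length ys) (\<lambda>(i, j). F (ys ! i) (ys ! j)))"
proof -
  define N where "N = length xs"
  have len: "length ys = N"
    using xs ys by (metis N_def distinct_card enumerates_def)
  have "\<exists>k<N. ys ! k = xs ! i" if "i < N" for i
    using xs ys that len by (metis N_def enumerates_def in_set_conv_nth)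
  then obtain \<sigma> where \<sigma>: "\<And>i. i < N \<Longrightarrow> \<sigma> i < N" "\<And>i. i < N \<Longrightarrow> ys ! \<sigma> i = xs ! i"
    by metis
  have inj: "\<sigma> i = \<sigma> j \<longleftrightarrow> i = j" if "i < N" "j < N" for i j
    using \<sigma>[OF that(1)] \<sigma>[OF that(2)] that xs N_def
    by (metis enumerates_def nth_eq_iff_index_eq)
  \<comment> \<open>Left multiplication by \<open>P\<close> replaces row \<open>i\<close> by row
    \<open>\<sigma> i\<close>; \<open>Q\<close> is the transpose of \<open>P\<close> and does the
    same to columns from the right.\<close>
  define P :: "'b mat" where "P = mat N N (\<lambda>(i, j). if j = \<sigma> i then 1 else 0)"
  define Q :: "'b mat" where "Q = mat N N (\<lambda>(i, j). if i = \<sigma> j then 1 else 0)"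
  define M where "M = mat N N (\<lambda>(i, j). F (ys ! i) (ys ! j))"
  have carr: "P \<in> carrier_mat N N" "Q \<in> carrier_mat N N" "M \<in> carrier_mat N N"
    by (auto simp: P_def Q_def M_def)
  have PX: "P * X = mat N N (\<lambda>(i, j). X $$ (\<sigma> i, j))" if "X \<in> carrier_mat N N" for X
    using that \<sigma> by (intro eq_matI) (auto simp: P_def scalar_prod_def if_distrib if_distribR cong: if_cong)
  have PQ: "P * Q = 1\<^sub>m N"
    unfolding PX[OF carr(2)] using \<sigma> inj by (intro eq_matI) (auto simp: Q_def)
  have "P * M * Q = mat N N (\<lambda>(i, j). F (xs ! i) (xs ! j))"
    unfolding PX[OF carr(3)] using \<sigma>
    by (intro eq_matI)
      (auto simp: Q_def M_def scalar_prod_def if_distrib if_distribR cong: if_cong)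
  then show ?thesis
    using mat_mult_left_right_inverse[OF carr(1,2) PQ] PQ carr
    unfolding N_def[symmetric] len M_def[symmetric]
    by (intro similar_matI[of _ _ P Q N]) auto
qed

lemma poly_char_poly_eq_det:
  fixes A :: "'a :: field mat"
  assumes "A \<in> carrier_mat n n"
  shows "poly (char_poly A) x = det (x \<cdot>\<^sub>m 1\<^sub>m n - A)"
proof -
  have "- char_matrix A x = x \<cdot>\<^sub>m 1\<^sub>m n - A"
    using assms by (intro eq_matI) (auto simp: char_matrix_def)
  then show ?thesis
    using char_poly_matrix[OF assms] by simp
qed

text \<open>Scalars and \<open>A\<close> commute with \<open>A\<close>, so linear polynomials in
  \<open>A\<close> multiply like ordinary ones. Products can then be compared by the coefficients of
  \<open>I\<close>, \<open>A\<close> and \<open>A * A\<close>.\<close>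

lemma mat_linear_mult:
  fixes A :: "'a :: comm_ring_1 mat"
  assumes "A \<in> carrier_mat n n"
  shows "(a \<cdot>\<^sub>m 1\<^sub>m n + b \<cdot>\<^sub>m A) * (c \<cdot>\<^sub>m 1\<^sub>m n + d \<cdot>\<^sub>m A) =
           (a * c) \<cdot>\<^sub>m 1\<^sub>m n + (a * d + b * c) \<cdot>\<^sub>m A + (b * d) \<cdot>\<^sub>m (A * A)"
proof -
  note A = assms
  have "(a \<cdot>\<^sub>m 1\<^sub>m n + b \<cdot>\<^sub>m A) * (c \<cdot>\<^sub>m 1\<^sub>m n + d \<cdot>\<^sub>m A) =
     (a \<cdot>\<^sub>m 1\<^sub>m n) * (c \<cdot>\<^sub>m 1\<^sub>m n + d \<cdot>\<^sub>m A) + (b \<cdot>\<^sub>m A) * (c \<cdot>\<^sub>m 1\<^sub>m n + d \<cdot>\<^sub>m A)"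
    using A by (intro add_mult_distrib_mat) auto
  also have "(a \<cdot>\<^sub>m 1\<^sub>m n) * (c \<cdot>\<^sub>m 1\<^sub>m n + d \<cdot>\<^sub>m A) = a \<cdot>\<^sub>m (c \<cdot>\<^sub>m 1\<^sub>m n + d \<cdot>\<^sub>m A)"
    using A by (subst mult_smult_assoc_mat) auto
  also have "(b \<cdot>\<^sub>m A) * (c \<cdot>\<^sub>m 1\<^sub>m n + d \<cdot>\<^sub>m A) = (b * c) \<cdot>\<^sub>m A + (b * d) \<cdot>\<^sub>m (A * A)"
  proof -
    have "(b \<cdot>\<^sub>m A) * (c \<cdot>\<^sub>m 1\<^sub>m n + d \<cdot>\<^sub>m A) = b \<cdot>\<^sub>m (A * (c \<cdot>\<^sub>m 1\<^sub>m n + d \<cdot>\<^sub>m A))"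
      using A by (subst mult_smult_assoc_mat) auto
    also have "A * (c \<cdot>\<^sub>m 1\<^sub>m n + d \<cdot>\<^sub>m A) = A * (c \<cdot>\<^sub>m 1\<^sub>m n) + A * (d \<cdot>\<^sub>m A)"
      using A by (intro mult_add_distrib_mat) auto
    also have "A * (c \<cdot>\<^sub>m 1\<^sub>m n) = c \<cdot>\<^sub>m A"
      using A by (subst mult_smult_distrib) auto
    also have "A * (d \<cdot>\<^sub>m A) = d \<cdot>\<^sub>m (A * A)"
      using A by (subst mult_smult_distrib) auto
    finally show ?thesis
      using A by (intro eq_matI) (auto simp: algebra_simps simp del: index_mult_mat(1))
  qed
  finally show ?thesis
    using A by (intro eq_matI) (auto simp: algebra_simps simp del: index_mult_mat(1))
qed

section \<open>Real polynomials that split, and spectra under affine maps\<close>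

text \<open>A nonzero difference would have infinitely many roots. Identities of characteristic
  polynomials may thus be checked for large arguments only.\<close>

lemma real_poly_eqI_eventually:
  fixes p q :: "real poly"
  assumes "\<And>x. x > c \<Longrightarrow> poly p x = poly q x"
  shows "p = q"
proof (rule ccontr)
  assume "p \<noteq> q"
  then have "finite {x. poly (p - q) x = 0}"
    by (intro poly_roots_finite) auto
  moreover have "{c<..} \<subseteq> {x. poly (p - q) x = 0}"
    using assms by auto
  ultimately show False
    using infinite_Ioi finite_subset by blast
qed

text \<open>The size condition says that \<open>p\<close> splits over the reals. The induction
  divides out the full power of one root at a time.\<close>

lemma monic_real_poly_eq_prod_proots:
  fixes p :: "real poly"
  assumes "lead_coeff p = 1" "size (proots p) = degree p"
  shows "p = (\<Prod>a\<in>#proots p. [:- a, 1:])"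
  using assms
proof (induction p rule: poly_root_order_induct)
  case 0
  then show ?case by simp
next
  \<comment> \<open>An empty root multiset forces degree 0, and a monic constant is 1, the empty
    product.\<close>
  case (no_roots p)
  then have "proots p = {#}"
    by (simp add: multiset_eqI order_root)
  then have "degree p = 0"
    using no_roots by simp
  then show ?case
    using no_roots \<open>proots p = {#}\<close> by (auto elim!: degree_eq_zeroE)
next
  case (root p x n)
  have p0: "p \<noteq> 0"
    using root.prems by auto
  have "[:- x, 1:] ^ n \<noteq> 0"
    by simp
  then have pr: "proots ([:- x, 1:] ^ n * p) = repeat_mset n {#x#} + proots p"
    using p0 by (simp add: proots_mult proots_power)
  have "lead_coeff p = 1"
    using root.prems(1) by (simp only: lead_coeff_mult lead_coeff_power) simp
  moreover have "degree ([:- x, 1:] ^ n * p) = n + degree p"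
    using p0 by (simp add: degree_mult_eq degree_linear_power)
  ultimately have "p = (\<Prod>a\<in>#proots p. [:- a, 1:])"
    using root.prems(2) pr by (intro root.IH) auto
  then show ?case
    unfolding pr by simp
qed

lemma prod_linear_nonzero: "(\<Prod>a\<in>#S. [:- a, 1:]) \<noteq> (0 :: real poly)"
  by (auto simp: prod_mset_zero_iff)

lemma proots_prod_linear:
  "proots (\<Prod>a\<in>#S. [:- a, 1:]) = (S :: real multiset)"
proof (induction S)
  case (add x S)
  then show ?case
    using add prod_linear_nonzero[of S] by (simp add: proots_mult del: mult_pCons_left)
qed simp

text \<open>For \<open>d \<noteq> 0\<close>, \<open>y I - (c I + d M)\<close> is \<open>d\<close>
  times \<open>((y - c) / d) I - M\<close>, so its determinant is a rescaled value of the
  characteristic polynomial of \<open>M\<close>.\<close>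

lemma char_poly_affine:
  fixes M :: "real mat"
  assumes M: "M \<in> carrier_mat N N" and cp: "char_poly M = (\<Prod>a\<in>#S. [:- a, 1:])"
  shows "char_poly (c \<cdot>\<^sub>m 1\<^sub>m N + d \<cdot>\<^sub>m M) = (\<Prod>a\<in>#S. [:- (c + d * a), 1:])"
proof (rule real_poly_eqI_eventually)
  fix y :: real
  \<comment> \<open>Comparing degrees gives one element of \<open>S\<close> per row, so
    \<open>d ^ N\<close> contributes one \<open>d\<close> to each linear factor.\<close>
  have "degree (\<Prod>a\<in>#S. [:- a, 1:]) = size S"
  proof (induction S)
    case (add x S)
    then show ?case
      using add prod_linear_nonzero[of S] by (simp add: degree_mult_eq del: mult_pCons_left)
  qed simp
  then have size: "size S = N"
    using degree_monic_char_poly[OF M] cp by simp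
  have "poly (char_poly (c \<cdot>\<^sub>m 1\<^sub>m N + d \<cdot>\<^sub>m M)) y = det (y \<cdot>\<^sub>m 1\<^sub>m N - (c \<cdot>\<^sub>m 1\<^sub>m N + d \<cdot>\<^sub>m M))"
    using M by (intro poly_char_poly_eq_det) auto
  also have "\<dots> = (\<Prod>a\<in>#S. y - (c + d * a))"
  proof (cases "d = 0")
    \<comment> \<open>This is \<alpha> = 1 in the application: the matrix is \<open>c I\<close>, and
      the number of equal factors must be \<open>N\<close>.\<close>
    case True
    then have "y \<cdot>\<^sub>m 1\<^sub>m N - (c \<cdot>\<^sub>m 1\<^sub>m N + d \<cdot>\<^sub>m M) = (y - c) \<cdot>\<^sub>m 1\<^sub>m N"
      using M by (intro eq_matI) auto
    then show ?thesis
      using True size by simp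
  next
    case False
    then have "y \<cdot>\<^sub>m 1\<^sub>m N - (c \<cdot>\<^sub>m 1\<^sub>m N + d \<cdot>\<^sub>m M) = d \<cdot>\<^sub>m (((y - c) / d) \<cdot>\<^sub>m 1\<^sub>m N - M)"
      using M by (intro eq_matI) (auto simp: field_simps)
    then have "det (y \<cdot>\<^sub>m 1\<^sub>m N - (c \<cdot>\<^sub>m 1\<^sub>m N + d \<cdot>\<^sub>m M)) = d ^ N * poly (char_poly M) ((y - c) / d)"
      using M by (simp add: poly_char_poly_eq_det[OF M])
    also have "\<dots> = (\<Prod>a\<in>#S. d * ((y - c) / d - a))"
      unfolding cp size[symmetric] by (induction S) (auto simp: algebra_simps)
    also have "(\<lambda>a. d * ((y - c) / d - a)) = (\<lambda>a. y - (c + d * a))"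
      using False by (auto simp: field_simps)
    finally show ?thesis .
  qed
  also have "\<dots> = poly (\<Prod>a\<in>#S. [:- (c + d * a), 1:]) y"
    by (induction S) (auto simp: algebra_simps)
  finally show "poly (char_poly (c \<cdot>\<^sub>m 1\<^sub>m N + d \<cdot>\<^sub>m M)) y = poly (\<Prod>a\<in>#S. [:- (c + d * a), 1:]) y" .
qed

section \<open>The Gram identity and the block determinant\<close>

text \<open>\<open>A + r I\<close> is a Gram matrix, hence positive semidefinite: for an eigenvector
  \<open>v\<close>, \<open>(k + r) * (v \<bullet> v)\<close> is the squared norm of
  \<open>B\<^sup>T *\<^sub>v v\<close>. The bound later makes the square roots real.\<close>

lemma eigenvalue_ge_of_gram:
  fixes A B :: "real mat"
  assumes A: "A \<in> carrier_mat n n" and B: "B \<in> carrier_mat n m"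
    and gram: "B * B\<^sup>T = A + r \<cdot>\<^sub>m 1\<^sub>m n" and ev: "eigenvalue A k"
  shows "- r \<le> k"
proof -
  obtain v where v: "v \<in> carrier_vec n" "v \<noteq> 0\<^sub>v n" "A *\<^sub>v v = k \<cdot>\<^sub>v v"
    using ev A by (auto simp: eigenvalue_def eigenvector_def)
  define w where "w = B\<^sup>T *\<^sub>v v"
  have w: "w \<in> carrier_vec m"
    using B v by (auto simp: w_def)
  have "(B * B\<^sup>T) *\<^sub>v v = (k + r) \<cdot>\<^sub>v v"
    unfolding gram using A v
    by (subst add_mult_distrib_mat_vec[of _ n n]) (auto intro!: eq_vecI simp: algebra_simps)
  then have "B *\<^sub>v w = (k + r) \<cdot>\<^sub>v v"
    using B v by (simp add: w_def)
  then have "(k + r) * (v \<bullet> v) = v \<bullet> (B *\<^sub>v w)"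
    using v by simp
  also have "\<dots> = w \<bullet> w"
    using transpose_vec_mult_scalar[OF B w v(1)] by (simp add: w_def)
  also have "\<dots> \<ge> 0"
    by (auto simp: scalar_prod_def intro: sum_nonneg)
  finally have "(k + r) * (v \<bullet> v) \<ge> 0" .
  moreover have "v \<bullet> v > 0"
    using conjugate_square_greater_0_vec[OF v(1)] v(2) by (simp add: scalar_prod_def conjugate_real_def)
  ultimately show ?thesis
    by (simp add: zero_le_mult_iff)
qed

text \<open>
  The row operation by \<open>- B\<^sup>T\<close> turns the lower right block of \<open>x I - T\<close>, for \<open>T\<close> the block matrix below,
  into the scalar matrix \<open>(x + 2) I\<close>; its Schur complement, multiplied by \<open>x + 2\<close>, is a monic quadratic in \<open>A\<close>, namely
  \<open>(a I - A) (b I - A)\<close>.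
\<close>

lemma det_total_block:
  fixes A B :: "real mat"
  assumes A: "A \<in> carrier_mat n n" and B: "B \<in> carrier_mat n m"
    and gram: "B * B\<^sup>T = A + r \<cdot>\<^sub>m 1\<^sub>m n" and x: "x \<noteq> -2"
    and ab: "a + b = 2 * x + 3 - r" "a * b = x\<^sup>2 + 2 * x - r * x - r"
  shows "(x + 2) ^ n * poly (char_poly (four_block_mat A B B\<^sup>T (B\<^sup>T * B - 2 \<cdot>\<^sub>m 1\<^sub>m m))) x =
           (x + 2) ^ m * poly (char_poly A) a * poly (char_poly A) b"
proof -
  define C where "C = B\<^sup>T"
  have C: "C \<in> carrier_mat m n"
    using B by (simp add: C_def)
  define R where "R = x \<cdot>\<^sub>m 1\<^sub>m n - A"
  \<comment> \<open>The row operation changes the lower left block \<open>- C\<close> into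
    \<open>- (C * R + C)\<close>, which is \<open>- (C * R')\<close>.\<close>
  define R' where "R' = (x + 1) \<cdot>\<^sub>m 1\<^sub>m n - A"
  \<comment> \<open>Chosen so that \<open>(x + 2) Y = C * R'\<close>: the column operation by
    \<open>Y\<close> then cancels the lower left block.\<close>
  define Y where "Y = (1 / (x + 2)) \<cdot>\<^sub>m (C * R')"
  have R: "R \<in> carrier_mat n n" "R' \<in> carrier_mat n n" "Y \<in> carrier_mat m n"
    using A C by (auto simp: R_def R'_def Y_def)
  define T where "T = four_block_mat A B C (C * B - 2 \<cdot>\<^sub>m 1\<^sub>m m)"
  have T: "T \<in> carrier_mat (n + m) (n + m)"
    using A B C by (auto simp: T_def)
  define D where "D = (x + 2) \<cdot>\<^sub>m 1\<^sub>m m - C * B"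
  have D: "D \<in> carrier_mat m m"
    using B C by (auto simp: D_def)
  have X: "x \<cdot>\<^sub>m 1\<^sub>m (n + m) - T = four_block_mat R (- B) (- C) D"
    using A B C by (intro eq_matI) (auto simp: T_def R_def D_def simp del: index_mult_mat(1))
  define E where "E = four_block_mat (1\<^sub>m n) (0\<^sub>m n m) (- C) (1\<^sub>m m)"
  define F where "F = four_block_mat (1\<^sub>m n) (0\<^sub>m n m) Y (1\<^sub>m m)"
  have dE: "det E = 1" and dF: "det F = 1"
    unfolding E_def F_def using C R
    by (simp_all add: det_four_block_mat_upper_right_zero[where n = n and m = m])
  have EX: "E * four_block_mat R (- B) (- C) D = four_block_mat R (- B) (- (C * R')) ((x + 2) \<cdot>\<^sub>m 1\<^sub>m m)"
  proof -
    have "C * R' = C * R + C"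
    proof -
      have "R' = R + 1\<^sub>m n"
        using A by (intro eq_matI) (auto simp: R_def R'_def)
      then show ?thesis
        using C R by (simp add: mult_add_distrib_mat[of _ m n])
    qed
    moreover have "- C * - B = C * B"
      using B C by simp
    ultimately show ?thesis
      unfolding E_def using B C D R
      by (subst mult_four_block_mat[where ?nr1.0 = n and ?nr2.0 = m and ?n1.0 = n and ?n2.0 = m and ?nc1.0 = n and ?nc2.0 = m])
        (auto intro!: cong_four_block_mat eq_matI simp: D_def simp del: index_mult_mat(1))
  qed
  have EXF: "E * four_block_mat R (- B) (- C) D * F =
      four_block_mat (R - B * Y) (- B) (0\<^sub>m m n) ((x + 2) \<cdot>\<^sub>m 1\<^sub>m m)"
  proof -
    have "((x + 2) \<cdot>\<^sub>m 1\<^sub>m m) * Y = C * R'"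
      using C R x by (subst mult_smult_assoc_mat[of _ m m]) (auto simp: Y_def intro!: eq_matI simp del: index_mult_mat(1))
    then show ?thesis
      unfolding EX F_def using B C D R
      by (subst mult_four_block_mat[where ?nr1.0 = n and ?nr2.0 = m and ?n1.0 = n and ?n2.0 = m and ?nc1.0 = n and ?nc2.0 = m])
        (auto intro!: cong_four_block_mat eq_matI simp del: index_mult_mat(1))
  qed
  have carrE: "E \<in> carrier_mat (n + m) (n + m)" "F \<in> carrier_mat (n + m) (n + m)"
    using C R by (auto simp: E_def F_def)
  have carrX: "four_block_mat R (- B) (- C) D \<in> carrier_mat (n + m) (n + m)"
    using R D by auto
  have "det (four_block_mat R (- B) (- C) D) = det (E * four_block_mat R (- B) (- C) D * F)"
    using carrE carrX dE dF by (simp add: det_mult[of _ "n + m"])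
  also have "\<dots> = det (R - B * Y) * det ((x + 2) \<cdot>\<^sub>m (1\<^sub>m m :: real mat))"
    unfolding EXF using B C D R by (intro det_four_block_mat_lower_left_zero) auto
  finally have detT: "poly (char_poly T) x = (x + 2) ^ m * det (R - B * Y)"
    using poly_char_poly_eq_det[OF T] X by simp
  \<comment> \<open>By the Gram identity \<open>B * Y\<close> is \<open>(A + r I) * R'\<close> over
    \<open>x + 2\<close>. After clearing the denominator both sides are quadratics in
    \<open>A\<close>, and \<open>ab\<close> matches their coefficients.\<close>
  have "(x + 2) \<cdot>\<^sub>m (R - B * Y) = (a \<cdot>\<^sub>m 1\<^sub>m n - A) * (b \<cdot>\<^sub>m 1\<^sub>m n - A)"
  proof -
    have "B * Y = (1 / (x + 2)) \<cdot>\<^sub>m (B * (C * R'))"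
      unfolding Y_def using B C R by (subst mult_smult_distrib) auto
    also have "B * (C * R') = (B * C) * R'"
      using B C R by simp
    also have "\<dots> = (r \<cdot>\<^sub>m 1\<^sub>m n + 1 \<cdot>\<^sub>m A) * ((x + 1) \<cdot>\<^sub>m 1\<^sub>m n + (-1) \<cdot>\<^sub>m A)"
      unfolding C_def gram using A by (intro arg_cong2[of _ _ _ _ "(*)"] eq_matI) (auto simp: R'_def)
    finally have BY: "B * Y = (1 / (x + 2)) \<cdot>\<^sub>m
        ((r * (x + 1)) \<cdot>\<^sub>m 1\<^sub>m n + (r * (-1) + 1 * (x + 1)) \<cdot>\<^sub>m A + (1 * (-1)) \<cdot>\<^sub>m (A * A))"
      unfolding mat_linear_mult[OF A] .
    have "(a \<cdot>\<^sub>m 1\<^sub>m n - A) * (b \<cdot>\<^sub>m 1\<^sub>m n - A) =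
        (a \<cdot>\<^sub>m 1\<^sub>m n + (-1) \<cdot>\<^sub>m A) * (b \<cdot>\<^sub>m 1\<^sub>m n + (-1) \<cdot>\<^sub>m A)"
      using A by (intro arg_cong2[of _ _ _ _ "(*)"] eq_matI) auto
    also have "\<dots> = (x\<^sup>2 + 2 * x - r * x - r) \<cdot>\<^sub>m 1\<^sub>m n + (- (2 * x + 3 - r)) \<cdot>\<^sub>m A + 1 \<cdot>\<^sub>m (A * A)"
      unfolding mat_linear_mult[OF A] ab[symmetric] by simp
    moreover have "(x + 2) \<cdot>\<^sub>m (R - (1 / (x + 2)) \<cdot>\<^sub>m K) = (x + 2) \<cdot>\<^sub>m R - K" if "K \<in> carrier_mat n n" for K
      using that R x by (intro eq_matI) (auto simp: right_diff_distrib)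
    ultimately show ?thesis
      unfolding BY using A
      by (simp, intro eq_matI) (auto simp: R_def power2_eq_square algebra_simps simp del: index_mult_mat(1))
  qed
  moreover have "det ((a \<cdot>\<^sub>m 1\<^sub>m n - A) * (b \<cdot>\<^sub>m 1\<^sub>m n - A)) = poly (char_poly A) a * poly (char_poly A) b"
    unfolding poly_char_poly_eq_det[OF A] using A by (intro det_mult) auto
  ultimately have "(x + 2) ^ n * det (R - B * Y) = poly (char_poly A) a * poly (char_poly A) b"
    using B R det_smult[of "x + 2" "R - B * Y"] by simp
  then show ?thesis
    unfolding C_def[symmetric] T_def[symmetric] detT by simp
qed

section \<open>Counting in the graph and in its total graph\<close>

lemma enumerates_nth: "enumerates xs S \<Longrightarrow> i < length xs \<Longrightarrow> xs ! i \<in> S"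
  unfolding enumerates_def by (metis nth_mem)

lemma simple_graphD:
  assumes "simple_graph G"
  shows "finite (vertices G)" "finite (edges G)"
    and "\<And>e. e \<in> edges G \<Longrightarrow> e \<subseteq> vertices G" "\<And>e. e \<in> edges G \<Longrightarrow> card e = 2"
    and "\<And>e. e \<in> edges G \<Longrightarrow> finite e"
proof -
  show "finite (vertices G)" "\<And>e. e \<in> edges G \<Longrightarrow> e \<subseteq> vertices G" "\<And>e. e \<in> edges G \<Longrightarrow> card e = 2"
    using assms by (auto simp: simple_graph_def)
  then show "finite (edges G)" "\<And>e. e \<in> edges G \<Longrightarrow> finite e"
    by (auto intro: finite_subset[of _ "Pow (vertices G)"] finite_subset[of _ "vertices G"])
qed

text \<open>The map from a neighbour \<open>u\<close> to the edge \<open>{v, u}\<close> is a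
  bijection. Neighbours of a vertex of the total graph are easy to count, since they separate into
  vertices and edges of \<open>G\<close>.\<close>

lemma vertex_degree_eq_card_neighbours:
  assumes "simple_graph G"
  shows "vertex_degree G v = card {u. {v, u} \<in> edges G}"
proof -
  have "{e \<in> edges G. v \<in> e} = (\<lambda>u. {v, u}) ` {u. {v, u} \<in> edges G}"
  proof (intro equalityI subsetI)
    fix e assume "e \<in> {e \<in> edges G. v \<in> e}"
    then have e: "e \<in> edges G" "v \<in> e" "card e = 2"
      using simple_graphD(4)[OF assms] by auto
    then obtain u where "e = {v, u}"
      by (auto simp: card_2_iff)
    then show "e \<in> (\<lambda>u. {v, u}) ` {u. {v, u} \<in> edges G}"
      using e by auto
  qed auto
  moreover have "inj_on (\<lambda>u. {v, u}) {u. {v, u} \<in> edges G}"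
    by (auto simp: inj_on_def doubleton_eq_iff)
  ultimately show ?thesis
    by (simp add: vertex_degree_def card_image)
qed

lemma edges_total_graph_iff [simp]:
  shows "{Inl u, Inl v} \<in> edges (total_graph G) \<longleftrightarrow> {u, v} \<in> edges G"
    and "{Inl v, Inr e} \<in> edges (total_graph G) \<longleftrightarrow> e \<in> edges G \<and> v \<in> e"
    and "{Inr e, Inl v} \<in> edges (total_graph G) \<longleftrightarrow> e \<in> edges G \<and> v \<in> e"
    and "{Inr e, Inr f} \<in> edges (total_graph G) \<longleftrightarrow>
           e \<in> edges G \<and> f \<in> edges G \<and> e \<noteq> f \<and> e \<inter> f \<noteq> {}"
  by (auto simp: total_graph_def doubleton_eq_iff insert_commute)

text \<open>A two-element edge through \<open>u\<close> and \<open>v\<close> can only be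
  \<open>{u, v}\<close>. These counts are the off-diagonal entries of
  \<open>B * B\<^sup>T\<close>.\<close>

lemma card_edges_containing_both:
  assumes "simple_graph G" "u \<noteq> v"
  shows "card {e \<in> edges G. u \<in> e \<and> v \<in> e} = (if {u, v} \<in> edges G then 1 else 0)"
proof -
  have eq: "e = {u, v}" if "e \<in> edges G" "u \<in> e" "v \<in> e" for e
    using simple_graphD(4)[OF assms(1) that(1)] that assms(2) by (auto simp: card_2_iff)
  show ?thesis
  proof (cases "{u, v} \<in> edges G")
    case True
    then have *: "{e \<in> edges G. u \<in> e \<and> v \<in> e} = {{u, v}}"
      using eq by blast
    show ?thesis
      unfolding * using True by simp
  next
    case False
    then have *: "{e \<in> edges G. u \<in> e \<and> v \<in> e} = {}"
      using eq by blast
    show ?thesis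
      unfolding * using False by simp
  qed
qed

text \<open>Distinct two-element sets share at most one point. These are the off-diagonal entries of
  \<open>B\<^sup>T * B\<close>.\<close>

lemma card_edge_Int:
  assumes "simple_graph G" "e \<in> edges G" "f \<in> edges G" "e \<noteq> f"
  shows "card (e \<inter> f) = (if e \<inter> f \<noteq> {} then 1 else 0)"
proof -
  obtain a b c d where "e = {a, b}" "f = {c, d}"
    using simple_graphD(4)[OF assms(1)] assms(2,3) by (meson card_2_iff)
  then show ?thesis
    using assms(4) by (auto simp: Int_insert_left)
qed

text \<open>A vertex of \<open>G\<close> has \<open>r\<close> neighbours and \<open>r\<close>
  incident edges; an edge has 2 endpoints and meets \<open>r - 1\<close> further edges at each of
  them.\<close>

lemma vertex_degree_total_graph:
  assumes G: "simple_graph G" and r: "regular_graph r G"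
    and t: "t \<in> vertices (total_graph G)"
  shows "vertex_degree (total_graph G) t = 2 * r"
proof -
  note deg = vertex_degree_eq_card_neighbours[OF simple_graph_total_graph[OF G]]
  have fin: "finite (edges G)"
    using simple_graphD[OF G] by blast
  have split: "{u. P u} = Inl ` {v. P (Inl v)} \<union> Inr ` {e. P (Inr e)}" for P :: "'a + 'a set \<Rightarrow> bool"
    by (auto simp: image_iff) (metis sum.exhaust)
  show ?thesis
  proof (cases t)
    case (Inl v)
    then have v: "vertex_degree G v = r"
      using t r by (auto simp: total_graph_def regular_graph_def)
    have "finite {u. {v, u} \<in> edges G}"
      using simple_graphD[OF G] by (auto intro!: finite_subset[of _ "vertices G"])
    moreover have "card {u. {v, u} \<in> edges G} = r"
      using v vertex_degree_eq_card_neighbours[OF G] by simp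
    moreover have "card {e \<in> edges G. v \<in> e} = r"
      using v by (simp add: vertex_degree_def)
    ultimately show ?thesis
      unfolding deg Inl split[of "\<lambda>u. {Inl v, u} \<in> _"] using fin
      by (subst card_Un_disjoint) (auto simp: card_image)
  next
    case (Inr e)
    then have e: "e \<in> edges G"
      using t by (auto simp: total_graph_def)
    obtain a b where ab: "e = {a, b}" "a \<noteq> b"
      using simple_graphD(4)[OF G e] by (auto simp: card_2_iff)
    define S where "S x = {f \<in> edges G. x \<in> f}" for x
    have S: "finite (S x)" for x
      using fin by (simp add: S_def)
    have Sr: "card (S x) = r" "e \<in> S x" if "x \<in> e" for x
      using r e that simple_graphD(3)[OF G e] by (auto simp: regular_graph_def vertex_degree_def S_def)
    \<comment> \<open>The edge \<open>e\<close> itself shows \<open>r \<ge> 1\<close>, so the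
      natural subtraction \<open>r - 1\<close> is not truncated.\<close>
    have card: "card (S x - {e}) = r - 1" "r \<ge> 1" if "x \<in> e" for x
      using Sr[OF that] S[of x] card_gt_0_iff[of "S x"] by (auto simp: card_Diff_singleton Suc_le_eq)
    have "{f. e \<in> edges G \<and> f \<in> edges G \<and> e \<noteq> f \<and> e \<inter> f \<noteq> {}} = (S a - {e}) \<union> (S b - {e})"
      using e ab by (auto simp: S_def)
    \<comment> \<open>No edge is counted at both endpoints: one through \<open>a\<close> and
      \<open>b\<close> would be \<open>e\<close>.\<close>
    moreover have "(S a - {e}) \<inter> (S b - {e}) = {}"
    proof -
      have "f = e" if "f \<in> edges G" "a \<in> f" "b \<in> f" for f
        using simple_graphD(4)[OF G that(1)] that ab by (auto simp: card_2_iff)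
      then show ?thesis
        by (auto simp: S_def)
    qed
    ultimately have "card {f. e \<in> edges G \<and> f \<in> edges G \<and> e \<noteq> f \<and> e \<inter> f \<noteq> {}} = 2 * (r - 1)"
      "finite {f. e \<in> edges G \<and> f \<in> edges G \<and> e \<noteq> f \<and> e \<inter> f \<noteq> {}}"
      using card S ab by (auto simp: card_Un_disjoint)
    moreover have "card {v. e \<in> edges G \<and> v \<in> e} = 2" "finite {v. e \<in> edges G \<and> v \<in> e}"
      using e simple_graphD(4,5)[OF G e] by simp_all
    moreover have "1 \<le> r"
      using card ab by auto
    ultimately show ?thesis
      unfolding deg Inr split[of "\<lambda>u. {Inr e, u} \<in> _"]
      by (subst card_Un_disjoint) (auto simp: card_image)
  qed
qed

text \<open>Incident pairs are counted once by vertices and once by edges. For \<open>r > 1\<close>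
  this yields \<open>n \<le> m\<close>, making \<open>m - n\<close> a true difference.\<close>

lemma regular_handshake:
  assumes "simple_graph G" "regular_graph r G"
  shows "2 * card (edges G) = r * card (vertices G)"
proof -
  have "(\<Sum>v\<in>vertices G. card {e \<in> edges G. v \<in> e}) = (\<Sum>e\<in>edges G. card {v \<in> vertices G. v \<in> e})"
    using simple_graphD[OF assms(1)] by (intro sum_multicount_gen) auto
  moreover have "{v \<in> vertices G. v \<in> e} = e" if "e \<in> edges G" for e
    using simple_graphD(3)[OF assms(1) that] by auto
  ultimately show ?thesis
    using assms simple_graphD(4)[OF assms(1)]
    by (simp add: regular_graph_def vertex_degree_def mult.commute)
qed

section \<open>The incidence matrix and the block form of the total graph\<close>

definition incidence_matrix :: "'v list \<Rightarrow> 'v set list \<Rightarrow> real mat" where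
  "incidence_matrix vs es = mat (length vs) (length es) (\<lambda>(i, j). if vs ! i \<in> es ! j then 1 else 0)"

lemma sum_nth_indicator:
  assumes "distinct xs"
  shows "(\<Sum>i = 0..<length xs. if P (xs ! i) then 1 else 0 :: real) = real (card {x \<in> set xs. P x})"
proof -
  have "(\<Sum>i = 0..<length xs. if P (xs ! i) then 1 else 0 :: real) = (\<Sum>x\<in>set xs. if P x then 1 else 0)"
    using sum.distinct_set_conv_list[OF assms, of "\<lambda>x. if P x then 1 else 0 :: real"]
    by (simp add: sum_list_sum_nth)
  then show ?thesis
    by (simp add: sum.If_cases Int_def)
qed

text \<open>Entry \<open>(i, j)\<close> counts the edges containing both vertices: the degree
  \<open>r\<close> on the diagonal, adjacency elsewhere.\<close>

lemma incidence_matrix_mult_transpose: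
  assumes G: "simple_graph G" "regular_graph r G"
    and vs: "enumerates vs (vertices G)" and es: "enumerates es (edges G)"
  shows "incidence_matrix vs es * (incidence_matrix vs es)\<^sup>T =
           adjacency_matrix G vs + real r \<cdot>\<^sub>m 1\<^sub>m (length vs)"
proof (rule eq_matI)
  fix i j assume "i < dim_row (adjacency_matrix G vs + real r \<cdot>\<^sub>m 1\<^sub>m (length vs))"
    "j < dim_col (adjacency_matrix G vs + real r \<cdot>\<^sub>m 1\<^sub>m (length vs))"
  then have ij: "i < length vs" "j < length vs"
    by auto
  have "(incidence_matrix vs es * (incidence_matrix vs es)\<^sup>T) $$ (i, j) =
      (\<Sum>k = 0..<length es. if vs ! i \<in> es ! k \<and> vs ! j \<in> es ! k then 1 else 0)"
    using ij by (auto simp: incidence_matrix_def scalar_prod_def intro!: sum.cong)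
  also have "\<dots> = real (card {e \<in> edges G. vs ! i \<in> e \<and> vs ! j \<in> e})"
    using es by (subst sum_nth_indicator) (auto simp: enumerates_def)
  also have "\<dots> = (adjacency_matrix G vs + real r \<cdot>\<^sub>m 1\<^sub>m (length vs)) $$ (i, j)"
  proof (cases "i = j")
    case True
    have "vs ! i \<in> vertices G"
      using enumerates_nth[OF vs] ij by blast
    then have "card {e \<in> edges G. vs ! i \<in> e} = r"
      using G(2) by (auto simp: regular_graph_def vertex_degree_def)
    \<comment> \<open>On the diagonal the adjacency test concerns the singleton
      \<open>{vs ! i}\<close>, which has the wrong cardinality for an edge.\<close>
    moreover have "{vs ! i} \<notin> edges G"
      using simple_graphD(4)[OF G(1), of "{vs ! i}"] by auto
    ultimately show ?thesis
      using True ij by (simp add: adjacency_matrix_def)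
  next
    case False
    then have "vs ! i \<noteq> vs ! j"
      using vs ij by (simp add: enumerates_def nth_eq_iff_index_eq)
    from card_edges_containing_both[OF G(1) this] show ?thesis
      using False ij by (simp add: adjacency_matrix_def)
  qed
  finally show "(incidence_matrix vs es * (incidence_matrix vs es)\<^sup>T) $$ (i, j) =
    (adjacency_matrix G vs + real r \<cdot>\<^sub>m 1\<^sub>m (length vs)) $$ (i, j)" .
qed (auto simp: incidence_matrix_def adjacency_matrix_def)

text \<open>\<open>B\<^sup>T * B\<close> counts common endpoints, 2 on the diagonal and 0 or 1
  elsewhere, so subtracting \<open>2 I\<close> leaves the adjacency of distinct edges.\<close>

lemma adjacency_matrix_total_graph:
  assumes G: "simple_graph G"
    and vs: "enumerates vs (vertices G)" and es: "enumerates es (edges G)"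
  defines "B \<equiv> incidence_matrix vs es"
  shows "adjacency_matrix (total_graph G) (map Inl vs @ map Inr es) =
           four_block_mat (adjacency_matrix G vs) B B\<^sup>T (B\<^sup>T * B - 2 \<cdot>\<^sub>m 1\<^sub>m (length es))"
proof -
  have BB: "(B\<^sup>T * B) $$ (i, j) = real (card (es ! i \<inter> es ! j))" if "i < length es" "j < length es" for i j
  proof -
    have "(B\<^sup>T * B) $$ (i, j) = (\<Sum>k = 0..<length vs. if vs ! k \<in> es ! i \<inter> es ! j then 1 else 0)"
      using that by (auto simp: B_def incidence_matrix_def scalar_prod_def intro!: sum.cong)
    also have "\<dots> = real (card {v \<in> vertices G. v \<in> es ! i \<inter> es ! j})"
      using vs by (subst sum_nth_indicator) (auto simp: enumerates_def)
    also have "{v \<in> vertices G. v \<in> es ! i \<inter> es ! j} = es ! i \<inter> es ! j"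
      using simple_graphD(3)[OF G, of "es ! i"] enumerates_nth[OF es that(1)] by blast
    finally show ?thesis .
  qed
  have L: "(if {Inr (es ! i), Inr (es ! j)} \<in> edges (total_graph G) then 1 else 0 :: real) =
      (B\<^sup>T * B - 2 \<cdot>\<^sub>m 1\<^sub>m (length es)) $$ (i, j)" if "i < length es" "j < length es" for i j
  proof -
    have e: "es ! i \<in> edges G" "es ! j \<in> edges G" "es ! i = es ! j \<longleftrightarrow> i = j"
      using enumerates_nth[OF es] that es by (simp_all add: enumerates_def nth_eq_iff_index_eq)
    have "dim_row B = length vs" "dim_col B = length es"
      by (auto simp: B_def incidence_matrix_def)
    then show ?thesis
      using that e simple_graphD(4)[OF G e(1)] card_edge_Int[OF G e(1,2)]
      by (auto simp: BB simp del: index_mult_mat(1))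
  qed
  show ?thesis
  proof (rule eq_matI)
    fix i j
    assume "i < dim_row (four_block_mat (adjacency_matrix G vs) B B\<^sup>T (B\<^sup>T * B - 2 \<cdot>\<^sub>m 1\<^sub>m (length es)))"
      "j < dim_col (four_block_mat (adjacency_matrix G vs) B B\<^sup>T (B\<^sup>T * B - 2 \<cdot>\<^sub>m 1\<^sub>m (length es)))"
    then have ij: "i < length vs + length es" "j < length vs + length es"
      by (auto simp: adjacency_matrix_def)
    have e: "es ! k \<in> edges G" if "k < length es" for k
      using enumerates_nth[OF es that] .
    show "adjacency_matrix (total_graph G) (map Inl vs @ map Inr es) $$ (i, j) =
      four_block_mat (adjacency_matrix G vs) B B\<^sup>T (B\<^sup>T * B - 2 \<cdot>\<^sub>m 1\<^sub>m (length es)) $$ (i, j)"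
    proof (cases "i < length vs \<or> j < length vs")
      case True
      then show ?thesis
        using ij e[of "i - length vs"] e[of "j - length vs"]
        by (auto simp: adjacency_matrix_def nth_append B_def incidence_matrix_def)
    next
      case False
      then show ?thesis
        using ij L[of "i - length vs" "j - length vs"]
        by (auto simp: adjacency_matrix_def nth_append simp del: index_mult_mat(1) edges_total_graph_iff index_minus_mat(1))
    qed
  qed (auto simp: adjacency_matrix_def)
qed

section \<open>The spectrum of the total graph and of its \<open>A_alpha_matrix\<close>\<close>

text \<open>This is the case \<alpha> = 0; the general case is an affine image of it. For each
  eigenvalue \<open>a\<close> of \<open>G\<close>, the two values \<open>\<mu> s a\<close> are the
  roots in \<open>x\<close> of the quadratic from the block determinant.\<close>

lemma char_poly_total_graph:
  assumes G: "simple_graph G" "regular_graph r G" and r: "r > 1"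
    and vs: "enumerates vs (vertices G)" and ts: "enumerates ts (vertices (total_graph G))"
    and cp: "char_poly (adjacency_matrix G vs) = (\<Prod>a\<in>#S. [:- a, 1:])"
  defines "\<mu> \<equiv> \<lambda>s a. (2 * a + real r - 2 + s * sqrt (4 * a + (real r)\<^sup>2 + 4)) / 2"
  shows "char_poly (adjacency_matrix (total_graph G) ts) =
    (\<Prod>a\<in>#replicate_mset (card (edges G) - card (vertices G)) (-2)
        + image_mset (\<mu> (-1)) S + image_mset (\<mu> 1) S. [:- a, 1:])"
proof -
  obtain es where es: "enumerates es (edges G)"
    using finite_distinct_list[OF simple_graphD(2)[OF G(1)]] by (auto simp: enumerates_def)
  have n: "length vs = card (vertices G)" and m: "length es = card (edges G)"
    using vs es by (auto simp: enumerates_def distinct_card[symmetric])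
  define n where "n = length vs"
  define m where "m = length es"
  have nm: "n \<le> m"
  proof -
    have "2 * card (vertices G) \<le> r * card (vertices G)"
      using r by (intro mult_le_mono1) simp
    then have "2 * card (vertices G) \<le> 2 * card (edges G)"
      by (simp only: regular_handshake[OF G])
    then show ?thesis
      by (simp add: n_def m_def n m)
  qed
  define A where "A = adjacency_matrix G vs"
  define B where "B = incidence_matrix vs es"
  have A: "A \<in> carrier_mat n n" and B: "B \<in> carrier_mat n m"
    by (auto simp: A_def B_def n_def m_def adjacency_matrix_def incidence_matrix_def)
  have gram: "B * B\<^sup>T = A + real r \<cdot>\<^sub>m 1\<^sub>m n"
    using incidence_matrix_mult_transpose[OF G vs es] by (simp add: A_def B_def n_def)
  define T where "T = four_block_mat A B B\<^sup>T (B\<^sup>T * B - 2 \<cdot>\<^sub>m 1\<^sub>m m)"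
  have "enumerates (map Inl vs @ map Inr es) (vertices (total_graph G))"
    using vs es by (auto simp: enumerates_def distinct_map total_graph_def)
  from similar_mat_reindex[OF ts this,
      of "\<lambda>t u. if {t, u} \<in> edges (total_graph G) then 1 else 0 :: real"]
  have "char_poly (adjacency_matrix (total_graph G) ts) =
      char_poly (adjacency_matrix (total_graph G) (map Inl vs @ map Inr es))"
    unfolding adjacency_matrix_def by (rule char_poly_similar)
  also have "\<dots> = char_poly T"
    by (simp add: adjacency_matrix_total_graph[OF G(1) vs es] T_def A_def B_def m_def)
  also have "\<dots> = (\<Prod>a\<in>#replicate_mset (m - n) (-2) + image_mset (\<mu> (-1)) S + image_mset (\<mu> 1) S. [:- a, 1:])"
  proof (rule real_poly_eqI_eventually)
    \<comment> \<open>The bound ensures \<open>x + 2 \<noteq> 0\<close> and a nonnegative radicand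
      in \<open>\<delta>\<close>.\<close>
    fix x :: real assume x: "x > (real r)\<^sup>2 + 2 * real r"
    have x0: "x > 0"
      by (rule le_less_trans[OF _ x]) simp
    txt \<open>For large \<open>x\<close> the quadratic in \<open>A\<close> has the real roots \<open>a\<close> and \<open>b\<close>.\<close>
    define \<delta> where "\<delta> = sqrt (4 * x + 9 + (real r)\<^sup>2 - 2 * real r)"
    define a where "a = (2 * x + 3 - r + \<delta>) / 2"
    define b where "b = (2 * x + 3 - r - \<delta>) / 2"
    have "4 * x + 9 + (real r)\<^sup>2 - 2 * real r \<ge> 0"
      using x x0 zero_le_power2[of "real r"] by linarith
    then have "\<delta>\<^sup>2 = 4 * x + 9 + (real r)\<^sup>2 - 2 * real r"
      by (simp add: \<delta>_def)
    then have ab: "a + b = 2 * x + 3 - real r" "a * b = x\<^sup>2 + 2 * x - real r * x - real r"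
      by (auto simp: a_def b_def field_simps power2_eq_square)
    have factor: "(a - k) * (b - k) = (x - \<mu> (-1) k) * (x - \<mu> 1 k)" if "k \<in># S" for k
    proof -
      have "poly (char_poly A) k = 0"
        using that cp by (auto simp: A_def poly_prod_mset prod_mset_zero_iff)
      then have "- real r \<le> k"
        using eigenvalue_ge_of_gram[OF A B gram] eigenvalue_root_char_poly[OF A] by simp
      \<comment> \<open>At the smallest possible eigenvalue \<open>- r\<close> the radicand is a
        perfect square, so it is nonnegative for all \<open>k\<close>.\<close>
      moreover have "4 * (- real r) + (real r)\<^sup>2 + 4 = (real r - 2)\<^sup>2"
        by (simp add: power2_eq_square algebra_simps)
      ultimately have "4 * k + (real r)\<^sup>2 + 4 \<ge> 0"
        using zero_le_power2[of "real r - 2"] by linarith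
      then have s: "(sqrt (4 * k + (real r)\<^sup>2 + 4))\<^sup>2 = 4 * k + (real r)\<^sup>2 + 4"
        by simp
      have "(a - k) * (b - k) = a * b - (a + b) * k + k\<^sup>2"
        by (simp add: power2_eq_square algebra_simps)
      \<comment> \<open>The quadratic is now read in \<open>x\<close> instead of \<open>k\<close>,
        and the square is completed.\<close>
      also have "\<dots> = ((2 * x - 2 * k - real r + 2)\<^sup>2 - (sqrt (4 * k + (real r)\<^sup>2 + 4))\<^sup>2) / 4"
        unfolding ab s by (simp add: power2_eq_square field_simps)
      also have "\<dots> = (x - \<mu> (-1) k) * (x - \<mu> 1 k)"
        by (simp add: \<mu>_def power2_eq_square field_simps)
      finally show ?thesis .
    qed
    have "poly (char_poly A) a * poly (char_poly A) b = (\<Prod>k\<in>#S. (a - k) * (b - k))"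
      using cp by (simp add: A_def poly_prod_mset prod_mset.distrib image_mset.compositionality o_def)
    also have "\<dots> = (\<Prod>k\<in>#S. (x - \<mu> (-1) k) * (x - \<mu> 1 k))"
      using factor by (simp cong: image_mset_cong)
    finally have "(x + 2) ^ n * poly (char_poly T) x =
        (x + 2) ^ m * (\<Prod>k\<in>#S. (x - \<mu> (-1) k) * (x - \<mu> 1 k))"
      using det_total_block[OF A B gram _ ab] x0 by (simp add: T_def mult.assoc)
    also have "(x + 2) ^ m = (x + 2) ^ n * (x + 2) ^ (m - n)"
      using nm by (simp flip: power_add)
    \<comment> \<open>Cancelling \<open>(x + 2) ^ n\<close> leaves the factor for the eigenvalue -2
      of multiplicity \<open>m - n\<close>.\<close>
    finally have "poly (char_poly T) x = (x + 2) ^ (m - n) * (\<Prod>k\<in>#S. (x - \<mu> (-1) k) * (x - \<mu> 1 k))"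
      using x0 by simp
    then show "poly (char_poly T) x = poly (\<Prod>a\<in>#replicate_mset (m - n) (-2) + image_mset (\<mu> (-1)) S
        + image_mset (\<mu> 1) S. [:- a, 1:]) x"
      by (simp add: poly_prod_mset prod_mset.distrib image_mset.compositionality o_def add.commute)
  qed
  finally show ?thesis
    by (simp add: n_def m_def n m)
qed

theorem theorem11:
  fixes G :: "'v graph" and r n m :: nat and \<alpha> :: real and lam :: "nat \<Rightarrow> real"
    and vs :: "'v list" and ts :: "('v + 'v set) list"
  assumes "simple_graph G"
    and "regular_graph r G" and "r > 1"
    and "n = card (vertices G)" and "m = card (edges G)"
    and "0 \<le> \<alpha>" and "\<alpha> \<le> 1"
    and "enumerates vs (vertices G)"
    and "enumerates ts (vertices (total_graph G))"
    and "eigenvalue_mset (adjacency_matrix G vs) = {#lam i. i \<in># mset_set {1..n}#}"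
  shows "eigenvalue_mset (A_alpha_matrix \<alpha> (total_graph G) ts) =
           replicate_mset (m - n) (2 * \<alpha> * (real r + 1) - 2)
         + {#1 / 2 * (- 2 * (\<alpha> - 1) * (lam i - 1) + real r * (3 * \<alpha> + 1)
               + (\<alpha> - 1) * sqrt (4 * lam i + (real r)\<^sup>2 + 4)). i \<in># mset_set {1..n}#}
         + {#1 / 2 * (- 2 * (\<alpha> - 1) * (lam i - 1) + real r * (3 * \<alpha> + 1)
               - (\<alpha> - 1) * sqrt (4 * lam i + (real r)\<^sup>2 + 4)). i \<in># mset_set {1..n}#}"
proof -
  define S where "S = image_mset lam (mset_set {1..n})"
  define A where "A = adjacency_matrix G vs"
  have "length vs = n"
    using assms by (auto simp: enumerates_def distinct_card[symmetric])
  then have A: "A \<in> carrier_mat n n"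
    by (simp add: A_def adjacency_matrix_def)
  have S: "proots (char_poly A) = S"
    using assms(10) by (simp add: A_def S_def eigenvalue_mset_def)
  \<comment> \<open>The \<open>n\<close> listed real eigenvalues exhaust the degree
    \<open>n\<close>, so the characteristic polynomial splits.\<close>
  have "char_poly A = (\<Prod>a\<in>#proots (char_poly A). [:- a, 1:])"
    using degree_monic_char_poly[OF A] S by (intro monic_real_poly_eq_prod_proots) (auto simp: S_def)
  then have cp: "char_poly (adjacency_matrix G vs) = (\<Prod>a\<in>#S. [:- a, 1:])"
    unfolding S by (simp add: A_def)
  define N where "N = length ts"
  define M where "M = adjacency_matrix (total_graph G) ts"
  have M: "M \<in> carrier_mat N N"
    by (simp add: M_def N_def adjacency_matrix_def)
  define \<mu> where "\<mu> s a = (2 * a + real r - 2 + s * sqrt (4 * a + (real r)\<^sup>2 + 4)) / 2" for s a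
  define U where "U = replicate_mset (m - n) (-2) + image_mset (\<mu> (-1)) S + image_mset (\<mu> 1) S"
  have cpM: "char_poly M = (\<Prod>a\<in>#U. [:- a, 1:])"
    using char_poly_total_graph[OF assms(1,2,3,8,9) cp] assms(4,5)
    unfolding M_def U_def \<mu>_def by simp
  have "vertex_degree (total_graph G) (ts ! i) = 2 * r" if "i < N" for i
    using enumerates_nth[OF assms(9)] that vertex_degree_total_graph[OF assms(1,2)] by (simp add: N_def)
  then have "A_alpha_matrix \<alpha> (total_graph G) ts = (2 * \<alpha> * real r) \<cdot>\<^sub>m 1\<^sub>m N + (1 - \<alpha>) \<cdot>\<^sub>m M"
    using M unfolding A_alpha_matrix_def M_def[symmetric]
    by (intro eq_matI) (auto simp: degree_matrix_def mat_diag_def N_def)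
  then have "eigenvalue_mset (A_alpha_matrix \<alpha> (total_graph G) ts) =
      image_mset (\<lambda>a. 2 * \<alpha> * real r + (1 - \<alpha>) * a) U"
    using char_poly_affine[OF M cpM, of "2 * \<alpha> * real r" "1 - \<alpha>"]
      proots_prod_linear[of "image_mset (\<lambda>a. 2 * \<alpha> * real r + (1 - \<alpha>) * a) U"]
    by (simp add: eigenvalue_mset_def image_mset.compositionality o_def)
  moreover have "2 * \<alpha> * real r + (1 - \<alpha>) * (-2) = 2 * \<alpha> * (real r + 1) - 2"
    by (simp add: algebra_simps)
  \<comment> \<open>Since \<open>1 - \<alpha>\<close> is the negative of
    \<open>\<alpha> - 1\<close>, the branch \<open>s = -1\<close> produces the plus sign of the
    statement.\<close>
  moreover have "2 * \<alpha> * real r + (1 - \<alpha>) * \<mu> (-1) a =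
      1 / 2 * (- 2 * (\<alpha> - 1) * (a - 1) + real r * (3 * \<alpha> + 1) + (\<alpha> - 1) * sqrt (4 * a + (real r)\<^sup>2 + 4))" for a
    by (simp add: \<mu>_def field_simps)
  moreover have "2 * \<alpha> * real r + (1 - \<alpha>) * \<mu> 1 a =
      1 / 2 * (- 2 * (\<alpha> - 1) * (a - 1) + real r * (3 * \<alpha> + 1) - (\<alpha> - 1) * sqrt (4 * a + (real r)\<^sup>2 + 4))" for a
    by (simp add: \<mu>_def field_simps)
  ultimately show ?thesis
    by (simp only: U_def S_def image_mset_union image_replicate_mset image_mset.compositionality o_def)
qed

end
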